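(* Every core-compact well-filtered $T_0$ space is sober.
   Context: Let $X$ be a $T_0$ space. $\mathcal O(X)$ denotes the set of all open subsets of $X$ and $\mathcal Q(X)$ the set of all compact saturated subsets of $X$ (including the empty set), where a subset is saturated if it equals the intersection of all open sets containing it. Compactness does not include the Hausdorff condition. For $A,B\subseteq X$, write $A\ll B$ if $A\subseteq B$ and every cover of $B$ by open subsets of $X$ contains a finite subfamily covering $A$. A nonempty family $\mathcal A$ of subsets of $X$ is $\ll$-filtered if for all $A_1,A_2\in\mathcal A$ there is $A_3\in\mathcal A$ with $A_3\ll A_1$ and $A_3\ll A_2$. (For $A\subseteq X$ and $Q\in\mathcal Q(X)$, $A\ll Q$ iff $A\subseteq Q$.) $X$ is well-filtered if for every $\ll$-filtered family $\mathcal K\subseteq\mathcal Q(X)$ and every $U\in\mathcal O(X)$, $\bigcap\mathcal K\subseteq U$ implies $K\subseteq U$ for some $K\in\mathcal K$. $X$ is core-compact if for every $x\in X$ and every open $U$ with $x\in U$ there is an open $V$ with $x\in V\ll U$. A nonempty subset $A$ of $X$ is irreducible if for any closed sets $F_1,F_2$, $A\subseteq F_1\cup F_2$ implies $A\subseteq F_1$ or $A\subseteq F_2$. A $T_0$ space $X$ is sober if every irreducible closed set $F$ is the closure of a point, i.e. $F=\mathrm{cl}(\{x\})$ for some $x\in X$. *)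

theory Defs
  imports "HOL-Analysis.Abstract_Topological_Spaces"
begin

definition saturated_in :: "'a topology \<Rightarrow> 'a set \<Rightarrow> bool" where
  "saturated_in X S \<longleftrightarrow> S \<subseteq> topspace X \<and> S = \<Inter>{U. openin X U \<and> S \<subseteq> U}"

definition compact_saturated :: "'a topology \<Rightarrow> 'a set set" where
  "compact_saturated X = {K. compactin X K \<and> saturated_in X K}"

definition way_below_in :: "'a topology \<Rightarrow> 'a set \<Rightarrow> 'a set \<Rightarrow> bool" where
  "way_below_in X A B \<longleftrightarrow>
     B \<subseteq> topspace X \<and> A \<subseteq> B \<and>
     (\<forall>\<U>. (\<forall>U\<in>\<U>. openin X U) \<and> B \<subseteq> \<Union>\<U> \<longrightarrow>
          (\<exists>\<F>. finite \<F> \<and> \<F> \<subseteq> \<U> \<and> A \<subseteq> \<Union>\<F>))"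

definition way_below_filtered :: "'a topology \<Rightarrow> 'a set set \<Rightarrow> bool" where
  "way_below_filtered X \<A> \<longleftrightarrow>
     \<A> \<noteq> {} \<and> (\<forall>A\<in>\<A>. A \<subseteq> topspace X) \<and>
     (\<forall>A1\<in>\<A>. \<forall>A2\<in>\<A>. \<exists>A3\<in>\<A>. way_below_in X A3 A1 \<and> way_below_in X A3 A2)"

definition well_filtered_space :: "'a topology \<Rightarrow> bool" where
  "well_filtered_space X \<longleftrightarrow>
     (\<forall>\<K> U. \<K> \<subseteq> compact_saturated X \<and> way_below_filtered X \<K> \<and> openin X U \<and> \<Inter>\<K> \<subseteq> U \<longrightarrow>
          (\<exists>K\<in>\<K>. K \<subseteq> U))"

definition core_compact_space :: "'a topology \<Rightarrow> bool" where
  "core_compact_space X \<longleftrightarrow>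
     (\<forall>x\<in>topspace X. \<forall>U. openin X U \<and> x \<in> U \<longrightarrow>
          (\<exists>V. openin X V \<and> x \<in> V \<and> way_below_in X V U))"

definition irreducible_in :: "'a topology \<Rightarrow> 'a set \<Rightarrow> bool" where
  "irreducible_in X A \<longleftrightarrow>
     A \<subseteq> topspace X \<and> A \<noteq> {} \<and>
     (\<forall>F1 F2. closedin X F1 \<and> closedin X F2 \<and> A \<subseteq> F1 \<union> F2 \<longrightarrow> A \<subseteq> F1 \<or> A \<subseteq> F2)"

definition sober_space :: "'a topology \<Rightarrow> bool" where
  "sober_space X \<longleftrightarrow>
     t0_space X \<and>
     (\<forall>F. closedin X F \<and> irreducible_in X F \<longrightarrow> (\<exists>x\<in>topspace X. F = X closure_of {x}))"

end

(* For a sequence of open sets with U (Suc n) way below U n in a well-filtered space, every open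
   neighbourhood of the intersection contains some U n: otherwise Zorn's lemma gives a maximal open
   W containing that neighbourhood and no U n. For points x n in U n - W, maximality forces every
   open set containing one x k to contain all but finitely many of them, so the saturations of the
   tails of x are compact; they form a filtered family with intersection inside W, which
   contradicts well-filteredness.
   Hence such an intersection is compact, and since the way-below relation interpolates in a
   core-compact space, every point has a neighbourhood base of compact saturated sets. The compact
   saturated sets whose interior meets a given irreducible closed set F are then filtered, and a
   common point of theirs in F is generic. *)

theory Submission
  imports Defs
begin

section \<open>The way-below relation and its interpolation property\<close>

lemma compactin_iff_way_below_in: "compactin X K \<longleftrightarrow> way_below_in X K K"
  unfolding compactin_def way_below_in_def by auto

lemma way_below_inD:
  assumes "way_below_in X A B" "\<And>U. U \<in> \<U> \<Longrightarrow> openin X U" "B \<subseteq> \<Union>\<U>"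
  shows "\<exists>\<F>. finite \<F> \<and> \<F> \<subseteq> \<U> \<and> A \<subseteq> \<Union>\<F>"
  using assms by (simp add: way_below_in_def)

lemma way_below_in_imp_subset: "way_below_in X A B \<Longrightarrow> A \<subseteq> B"
  by (simp add: way_below_in_def)

lemma way_below_in_mono:
  assumes "way_below_in X A B" "A' \<subseteq> A" "B \<subseteq> B'" "B' \<subseteq> topspace X"
  shows "way_below_in X A' B'"
  unfolding way_below_in_def
proof (intro conjI allI impI)
  show "A' \<subseteq> B'" using assms(2,3) way_below_in_imp_subset[OF assms(1)] by blast
next
  fix \<U> assume "(\<forall>U\<in>\<U>. openin X U) \<and> B' \<subseteq> \<Union>\<U>"
  then have "\<forall>U\<in>\<U>. openin X U" "B \<subseteq> \<Union>\<U>" using assms(3) by auto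
  then obtain \<F> where "finite \<F>" "\<F> \<subseteq> \<U>" "A \<subseteq> \<Union>\<F>"
    using way_below_inD[OF assms(1), of \<U>] by blast
  then show "\<exists>\<F>. finite \<F> \<and> \<F> \<subseteq> \<U> \<and> A' \<subseteq> \<Union>\<F>" using assms(2) by blast
qed (use assms in auto)

lemma way_below_in_Un:
  assumes "way_below_in X A C" "way_below_in X B C"
  shows "way_below_in X (A \<union> B) C"
  unfolding way_below_in_def
proof (intro conjI allI impI)
  fix \<U> assume \<U>: "(\<forall>U\<in>\<U>. openin X U) \<and> C \<subseteq> \<Union>\<U>"
  obtain \<F> where "finite \<F>" "\<F> \<subseteq> \<U>" "A \<subseteq> \<Union>\<F>"
    using way_below_inD[OF assms(1), of \<U>] \<U> by blast
  moreover obtain \<G> where "finite \<G>" "\<G> \<subseteq> \<U>" "B \<subseteq> \<Union>\<G>"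
    using way_below_inD[OF assms(2), of \<U>] \<U> by blast
  ultimately show "\<exists>\<F>. finite \<F> \<and> \<F> \<subseteq> \<U> \<and> A \<union> B \<subseteq> \<Union>\<F>"
    by (intro exI[of _ "\<F> \<union> \<G>"]) auto
qed (use assms in \<open>auto simp: way_below_in_def\<close>)

lemma way_below_in_Union:
  assumes "finite \<A>" "\<And>A. A \<in> \<A> \<Longrightarrow> way_below_in X A C" "C \<subseteq> topspace X"
  shows "way_below_in X (\<Union>\<A>) C"
  using assms
proof (induction \<A> rule: finite_induct)
  case empty
  then show ?case by (auto simp: way_below_in_def)
next
  case (insert A \<A>)
  then show ?case by (simp add: way_below_in_Un)
qed

text \<open>Core-compactness used twice at each point of \<open>U\<close> produces open
  \<open>B\<close> and \<open>A\<close> with the point in \<open>B\<close>, \<open>B\<close> way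
  below \<open>A\<close> and \<open>A\<close> way below \<open>U\<close>. Finitely many such
  \<open>B\<close> cover \<open>V\<close>, and the union of the corresponding \<open>A\<close>
  interpolates.\<close>

lemma way_below_in_interpolate:
  assumes cc: "core_compact_space X" and VU: "way_below_in X V U" and "openin X U"
  shows "\<exists>W. openin X W \<and> way_below_in X V W \<and> way_below_in X W U"
proof -
  define \<P> where "\<P> = {B. openin X B \<and> (\<exists>A. openin X A \<and> way_below_in X B A \<and> way_below_in X A U)}"
  have "U \<subseteq> \<Union>\<P>"
  proof
    fix x assume x: "x \<in> U"
    then obtain A where A: "openin X A" "x \<in> A" "way_below_in X A U"
      using cc \<open>openin X U\<close> openin_subset unfolding core_compact_space_def by (meson subsetD)
    then obtain B where "openin X B" "x \<in> B" "way_below_in X B A"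
      using cc openin_subset unfolding core_compact_space_def by (meson subsetD)
    with A show "x \<in> \<Union>\<P>" unfolding \<P>_def by blast
  qed
  moreover have "\<forall>B\<in>\<P>. openin X B" by (simp add: \<P>_def)
  ultimately obtain \<F> where \<F>: "finite \<F>" "\<F> \<subseteq> \<P>" "V \<subseteq> \<Union>\<F>"
    using way_below_inD[OF VU, of \<P>] by blast
  have "\<forall>B\<in>\<F>. \<exists>A. openin X A \<and> way_below_in X B A \<and> way_below_in X A U"
    using \<F>(2) unfolding \<P>_def by blast
  then obtain a where
    a: "\<And>B. B \<in> \<F> \<Longrightarrow> openin X (a B) \<and> way_below_in X B (a B) \<and> way_below_in X (a B) U"
    by metis
  define W where "W = \<Union>(a ` \<F>)"
  have W: "openin X W" using a by (auto simp: W_def)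
  then have WX: "W \<subseteq> topspace X" by (rule openin_subset)
  have "way_below_in X (\<Union>\<F>) W"
  proof (rule way_below_in_Union[OF \<F>(1) _ WX])
    fix B assume "B \<in> \<F>"
    then show "way_below_in X B W"
      using way_below_in_mono[of X B "a B" B W] a[OF \<open>B \<in> \<F>\<close>] WX
      by (auto simp: W_def)
  qed
  then have "way_below_in X V W" using \<F>(3) order_refl WX by (rule way_below_in_mono)
  moreover have "way_below_in X W U"
    unfolding W_def using \<F>(1) a openin_subset[OF \<open>openin X U\<close>]
    by (intro way_below_in_Union) auto
  ultimately show ?thesis using W by blast
qed

section \<open>Saturations and families of compact saturated sets\<close>

definition saturation_in :: "'a topology \<Rightarrow> 'a set \<Rightarrow> 'a set" where
  "saturation_in X S = \<Inter>{U. openin X U \<and> S \<subseteq> U}"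

lemma saturation_in_subset: "S \<subseteq> saturation_in X S"
  by (auto simp: saturation_in_def)

lemma saturation_in_minimal: "openin X U \<Longrightarrow> S \<subseteq> U \<Longrightarrow> saturation_in X S \<subseteq> U"
  by (auto simp: saturation_in_def)

lemma saturation_in_mono: "S \<subseteq> T \<Longrightarrow> saturation_in X S \<subseteq> saturation_in X T"
  by (auto simp: saturation_in_def)

lemma saturated_in_Inter_open:
  assumes "\<U> \<noteq> {}" "\<And>U. U \<in> \<U> \<Longrightarrow> openin X U"
  shows "saturated_in X (\<Inter>\<U>)"
proof -
  have "\<Inter>\<U> \<subseteq> topspace X" using assms openin_subset by blast
  moreover have "\<Inter>{U. openin X U \<and> \<Inter>\<U> \<subseteq> U} \<subseteq> \<Inter>\<U>"
    using assms(2) by (intro Inter_greatest Inter_lower) auto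
  ultimately show ?thesis unfolding saturated_in_def by auto
qed

text \<open>An open set containing \<open>S\<close> already contains its saturation, so a finite
  subcover of \<open>S\<close> also covers the saturation.\<close>

lemma compact_saturated_saturation_in:
  assumes "compactin X S"
  shows "saturation_in X S \<in> compact_saturated X"
proof -
  have SX: "S \<subseteq> topspace X" using assms by (rule compactin_subset_topspace)
  have "compactin X (saturation_in X S)"
    unfolding compactin_def
  proof (intro conjI allI impI)
    show "saturation_in X S \<subseteq> topspace X" using SX by (simp add: saturation_in_minimal)
  next
    fix \<U> assume \<U>: "Ball \<U> (openin X) \<and> saturation_in X S \<subseteq> \<Union>\<U>"
    then have "S \<subseteq> \<Union>\<U>" using saturation_in_subset by fast
    then obtain \<F> where \<F>: "finite \<F>" "\<F> \<subseteq> \<U>" "S \<subseteq> \<Union>\<F>"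
      using compactinD[OF assms] \<U> by metis
    moreover have "saturation_in X S \<subseteq> \<Union>\<F>"
      using \<F> \<U> by (intro saturation_in_minimal) auto
    ultimately show "\<exists>\<F>. finite \<F> \<and> \<F> \<subseteq> \<U> \<and> saturation_in X S \<subseteq> \<Union>\<F>" by blast
  qed
  \<comment> \<open>\<open>SX\<close> makes \<open>topspace X\<close> a member of the intersected
    family; an empty family would give \<open>UNIV\<close>.\<close>
  moreover have "saturated_in X (saturation_in X S)"
    unfolding saturation_in_def by (rule saturated_in_Inter_open) (use SX in auto)
  ultimately show ?thesis by (simp add: compact_saturated_def)
qed

text \<open>A compact set is way below itself, hence way below every larger subset of the space, so
  being filtered under inclusion suffices.\<close>

lemma way_below_filtered_compact:
  assumes "\<K> \<noteq> {}" "\<K> \<subseteq> compact_saturated X"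
    and "\<And>K L. K \<in> \<K> \<Longrightarrow> L \<in> \<K> \<Longrightarrow> \<exists>M\<in>\<K>. M \<subseteq> K \<and> M \<subseteq> L"
  shows "way_below_filtered X \<K>"
proof -
  have K: "compactin X K" "K \<subseteq> topspace X" if "K \<in> \<K>" for K
    using assms(2) that compactin_subset_topspace unfolding compact_saturated_def by auto
  have "\<exists>M\<in>\<K>. way_below_in X M K \<and> way_below_in X M L" if KL: "K \<in> \<K>" "L \<in> \<K>" for K L
  proof -
    obtain M where "M \<in> \<K>" "M \<subseteq> K" "M \<subseteq> L" using assms(3)[OF KL] by blast
    moreover from this have "way_below_in X M M"
      using K(1) by (simp add: compactin_iff_way_below_in)
    ultimately show ?thesis
      using way_below_in_mono[of X M M M K] way_below_in_mono[of X M M M L] K(2) KL by auto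
  qed
  then show ?thesis using assms(1) K(2) unfolding way_below_filtered_def by blast
qed

section \<open>Well-filteredness applied to way-below sequences of open sets\<close>

lemma well_filtered_way_below_sequence:
  fixes U :: "nat \<Rightarrow> 'a set"
  assumes wf: "well_filtered_space X"
    and U: "\<And>n. openin X (U n)" "\<And>n. way_below_in X (U (Suc n)) (U n)"
    and G: "openin X G" "(\<Inter>n. U n) \<subseteq> G"
  shows "\<exists>n. U n \<subseteq> G"
proof (rule ccontr)
  assume neg: "\<not> (\<exists>n. U n \<subseteq> G)"
  define \<A> where "\<A> = {W. openin X W \<and> G \<subseteq> W \<and> (\<forall>n. \<not> U n \<subseteq> W)}"
  have dec: "U n \<subseteq> U m" if "m \<le> n" for m n
    by (rule lift_Suc_antimono_le[OF _ that]) (rule way_below_in_imp_subset[OF U(2)])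
  have "\<exists>W\<in>\<A>. \<forall>V\<in>\<A>. W \<subseteq> V \<longrightarrow> V = W"
  proof (rule subset_Zorn_nonempty)
    show "\<A> \<noteq> {}" using neg G by (auto simp: \<A>_def)
  next
    fix \<C> assume \<C>: "\<C> \<noteq> {}" "subset.chain \<A> \<C>"
    then have "\<C> \<subseteq> \<A>" by (simp add: subset.chain_def)
    then have op: "\<forall>V\<in>\<C>. openin X V" by (auto simp: \<A>_def)
    \<comment> \<open>Finitely many members of the chain would cover \<open>U (Suc n)\<close>, so a
      single one would contain it; the index moves by one because only \<open>U (Suc n)\<close> is
      way below \<open>U n\<close>.\<close>
    have "\<not> U n \<subseteq> \<Union>\<C>" for n
    proof
      assume "U n \<subseteq> \<Union>\<C>"
      then obtain \<F> where \<F>: "finite \<F>" "\<F> \<subseteq> \<C>" "U (Suc n) \<subseteq> \<Union>\<F>"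
        using way_below_inD[OF U(2)[of n], of \<C>] op by blast
      have "\<exists>V\<in>\<C>. \<Union>\<F> \<subseteq> V"
      \<comment> \<open>A nonempty finite chain has a largest member. For the empty subfamily any
        member of \<open>\<C>\<close> will do.\<close>
      proof (cases "\<F> = {}")
        case True
        then show ?thesis using \<C>(1) by auto
      next
        case False
        have "subset.chain \<A> \<F>"
          using \<C>(2) \<F>(2) unfolding subset.chain_def by blast
        then have "\<Union>\<F> \<in> \<F>" using False \<F>(1) Union_in_chain by blast
        then show ?thesis using \<F>(2) by blast
      qed
      then obtain V where "V \<in> \<C>" "\<Union>\<F> \<subseteq> V" by (rule bexE)
      then have "V \<in> \<A>" "U (Suc n) \<subseteq> V" using \<F>(3) \<open>\<C> \<subseteq> \<A>\<close> by auto
      then show False by (simp add: \<A>_def)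
    qed
    moreover have "G \<subseteq> \<Union>\<C>" using \<C>(1) \<open>\<C> \<subseteq> \<A>\<close> by (auto simp: \<A>_def)
    ultimately show "\<Union>\<C> \<in> \<A>" using op by (auto simp: \<A>_def)
  qed
  then obtain W where "W \<in> \<A>" and max: "\<And>V. V \<in> \<A> \<Longrightarrow> W \<subseteq> V \<Longrightarrow> V = W"
    by blast
  then have W: "openin X W" "G \<subseteq> W" "\<And>n. \<not> U n \<subseteq> W" by (auto simp: \<A>_def)
  have "\<forall>n. \<exists>x. x \<in> U n \<and> x \<notin> W" using W(3) by blast
  then obtain x where x: "\<And>n. x n \<in> U n" "\<And>n. x n \<notin> W" by metis
  \<comment> \<open>\<open>W \<union> V\<close> properly extends \<open>W\<close>, as it contains
    \<open>x k\<close>; by maximality it contains some \<open>U m\<close>. From \<open>m\<close> on,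
    the points lie in \<open>U m\<close> but outside \<open>W\<close>, hence in
    \<open>V\<close>.\<close>
  have tail: "\<exists>m. \<forall>n\<ge>m. x n \<in> V" if V: "openin X V" "x k \<in> V" for V k
  proof -
    have "W \<union> V \<notin> \<A>" using max[of "W \<union> V"] V x(2) by blast
    then obtain m where "U m \<subseteq> W \<union> V" using W V unfolding \<A>_def by blast
    then show ?thesis using x dec by blast
  qed
  have comp: "compactin X (x ` {n..})" for n
    unfolding compactin_def
  proof (intro conjI allI impI)
    show "x ` {n..} \<subseteq> topspace X" using x(1) U(1) openin_subset by blast
  next
    fix \<U> assume \<U>: "Ball \<U> (openin X) \<and> x ` {n..} \<subseteq> \<Union>\<U>"
    then have "\<forall>k\<in>{n..}. \<exists>V\<in>\<U>. x k \<in> V" by blast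
    then obtain v where v: "\<And>k. k \<ge> n \<Longrightarrow> v k \<in> \<U> \<and> x k \<in> v k" by (metis atLeast_iff)
    \<comment> \<open>The one member \<open>v n\<close> covers all points from index
      \<open>m\<close> on; the finitely many before it need one member each.\<close>
    then obtain m where m: "\<And>k. k \<ge> m \<Longrightarrow> x k \<in> v n" using tail[of "v n" n] \<U> by blast
    have "x k \<in> \<Union>(insert (v n) (v ` {n..<m}))" if "k \<ge> n" for k
      using m[of k] v[of k] that by (cases "k < m") auto
    then show "\<exists>\<F>. finite \<F> \<and> \<F> \<subseteq> \<U> \<and> x ` {n..} \<subseteq> \<Union>\<F>"
      using v by (intro exI[of _ "insert (v n) (v ` {n..<m})"]) auto
  qed
  define K where "K n = saturation_in X (x ` {n..})" for n
  have K: "range K \<subseteq> compact_saturated X"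
    using comp by (auto simp: K_def intro: compact_saturated_saturation_in)
  have filt: "way_below_filtered X (range K)"
  proof (rule way_below_filtered_compact[OF _ K])
    fix L M assume "L \<in> range K" "M \<in> range K"
    then obtain i j where "L = K i" "M = K j" by blast
    moreover have "K (max i j) \<subseteq> K i" "K (max i j) \<subseteq> K j"
      unfolding K_def by (intro saturation_in_mono; auto)+
    ultimately show "\<exists>N\<in>range K. N \<subseteq> L \<and> N \<subseteq> M" by blast
  qed simp
  have "K n \<subseteq> U n" for n
    unfolding K_def
  proof (rule saturation_in_minimal[OF U(1)])
    show "x ` {n..} \<subseteq> U n"
    proof
      fix y assume "y \<in> x ` {n..}"
      then obtain k where "k \<ge> n" "y = x k" by auto
      then show "y \<in> U n" using x(1)[of k] dec[of n k] by blast
    qed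
  qed
  then have "\<Inter>(range K) \<subseteq> (\<Inter>n. U n)" by (rule INF_mono')
  \<comment> \<open>The target is \<open>W\<close> rather than \<open>G\<close>, because each
    \<open>K n\<close> contains \<open>x n\<close>, which lies outside \<open>W\<close>.\<close>
  then have "\<Inter>(range K) \<subseteq> W" using G(2) W(2) by (meson order_trans)
  then have "\<exists>L\<in>range K. L \<subseteq> W"
    using wf[unfolded well_filtered_space_def, rule_format, of "range K" W] K filt W(1) by simp
  then obtain n where "K n \<subseteq> W" by blast
  moreover have "x n \<in> K n" using saturation_in_subset[of "x ` {n..}" X] by (auto simp: K_def)
  ultimately show False using x(2) by blast
qed

section \<open>Neighbourhood bases of compact saturated sets\<close>

lemma core_compact_well_filtered_interpolant:
  assumes cc: "core_compact_space X" and wf: "well_filtered_space X"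
    and VU: "way_below_in X V U" and "openin X U"
  shows "\<exists>K\<in>compact_saturated X. V \<subseteq> K \<and> K \<subseteq> U"
proof -
  let ?P = "\<lambda>_::nat. \<lambda>W. openin X W \<and> way_below_in X V W"
  have "\<exists>W. (\<forall>n. ?P n (W n) \<and> way_below_in X (W (Suc n)) (W n)) \<and> W 0 = U"
  proof -
    \<comment> \<open>Each interpolant still has \<open>V\<close> way below it, so interpolation can
      be iterated downwards from \<open>U\<close>.\<close>
    define step where
      "step A = (SOME B. openin X B \<and> way_below_in X V B \<and> way_below_in X B A)" for A
    have step: "openin X (step A) \<and> way_below_in X V (step A) \<and> way_below_in X (step A) A"
      if "openin X A" "way_below_in X V A" for A
      unfolding step_def by (rule someI_ex) (use way_below_in_interpolate[OF cc] that in blast)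
    have "?P n ((step ^^ n) U)" for n
      by (induction n) (use assms step in auto)
    then show ?thesis using step by (intro exI[of _ "\<lambda>n. (step ^^ n) U"]) auto
  qed
  then obtain W where W: "\<And>n. openin X (W n)" "\<And>n. way_below_in X V (W n)"
    "\<And>n. way_below_in X (W (Suc n)) (W n)" "W 0 = U"
    by blast
  define K where "K = (\<Inter>n. W n)"
  have "compactin X K"
    unfolding compactin_def
  proof (intro conjI allI impI)
    show "K \<subseteq> topspace X" using W(1)[of 0] openin_subset unfolding K_def by blast
  next
    fix \<U> assume \<U>: "Ball \<U> (openin X) \<and> K \<subseteq> \<Union>\<U>"
    \<comment> \<open>The union of the cover is an open set containing the intersection, so it
      contains some \<open>W n\<close>; then \<open>W (Suc n)\<close>, and with it \<open>K\<close>,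
      is covered by finitely many members.\<close>
    then obtain n where "W n \<subseteq> \<Union>\<U>"
      using well_filtered_way_below_sequence[of X W "\<Union>\<U>"] wf W(1,3) openin_Union[of \<U> X]
      unfolding K_def by metis
    then obtain \<F> where "finite \<F>" "\<F> \<subseteq> \<U>" "W (Suc n) \<subseteq> \<Union>\<F>"
      using way_below_inD[OF W(3)[of n], of \<U>] \<U> by blast
    then show "\<exists>\<F>. finite \<F> \<and> \<F> \<subseteq> \<U> \<and> K \<subseteq> \<Union>\<F>" unfolding K_def by blast
  qed
  moreover have "saturated_in X K"
    unfolding K_def using W(1) by (intro saturated_in_Inter_open) auto
  moreover have "V \<subseteq> K" using W(2) way_below_in_imp_subset unfolding K_def by blast
  moreover have "K \<subseteq> U" using W(4) unfolding K_def by blast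
  ultimately show ?thesis by (auto simp: compact_saturated_def)
qed

lemma core_compact_well_filtered_neighbourhood:
  assumes "core_compact_space X" "well_filtered_space X" "openin X U" "x \<in> U"
  shows "\<exists>V K. openin X V \<and> x \<in> V \<and> V \<subseteq> K \<and> K \<subseteq> U \<and> K \<in> compact_saturated X"
proof -
  obtain V where V: "openin X V" "x \<in> V" "way_below_in X V U"
    using assms(1,3,4) openin_subset unfolding core_compact_space_def by (meson subsetD)
  then show ?thesis
    using core_compact_well_filtered_interpolant[OF assms(1,2) V(3) assms(3)] by blast
qed

text \<open>Otherwise the complements of \<open>U\<close> and \<open>V\<close> would be closed sets
  covering \<open>F\<close>, neither of which covers it alone. This is what makes the family
  \<open>\<K>\<close> below filtered.\<close>

lemma irreducible_in_open_Int:
  assumes "irreducible_in X F" "openin X U" "openin X V" "U \<inter> F \<noteq> {}" "V \<inter> F \<noteq> {}"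
  shows "U \<inter> V \<inter> F \<noteq> {}"
proof
  assume "U \<inter> V \<inter> F = {}"
  then have "F \<subseteq> (topspace X - U) \<union> (topspace X - V)"
    using assms(1) unfolding irreducible_in_def by blast
  moreover have "closedin X (topspace X - U)" "closedin X (topspace X - V)"
    using assms(2,3) by auto
  ultimately have "F \<subseteq> topspace X - U \<or> F \<subseteq> topspace X - V"
    using assms(1) unfolding irreducible_in_def by blast
  then show False using assms(4,5) by blast
qed

section \<open>Generic points of irreducible closed sets\<close>

theorem corollary4p8:
  fixes X :: "'a topology"
  assumes "t0_space X" and "core_compact_space X" and "well_filtered_space X"
  shows "sober_space X"
  unfolding sober_space_def
proof (intro conjI allI impI)
  show "t0_space X" by fact
next
  fix F assume "closedin X F \<and> irreducible_in X F"
  then have F: "closedin X F" "irreducible_in X F" by auto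
  then have FX: "F \<subseteq> topspace X" "F \<noteq> {}" by (auto simp: irreducible_in_def)
  define \<K> where "\<K> = {K \<in> compact_saturated X. \<exists>V. openin X V \<and> V \<inter> F \<noteq> {} \<and> V \<subseteq> K}"
  have small: "\<exists>K\<in>\<K>. K \<subseteq> U" if U: "openin X U" "U \<inter> F \<noteq> {}" for U
  proof -
    obtain x where "x \<in> U" "x \<in> F" using U by blast
    then show ?thesis
      using core_compact_well_filtered_neighbourhood[OF assms(2,3) U(1), of x]
      unfolding \<K>_def by blast
  qed
  have \<K>: "\<K> \<subseteq> compact_saturated X" by (auto simp: \<K>_def)
  have "way_below_filtered X \<K>"
  proof (rule way_below_filtered_compact[OF _ \<K>])
    show "\<K> \<noteq> {}" using small[of "topspace X"] FX by auto
  next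
    fix K L assume "K \<in> \<K>" "L \<in> \<K>"
    then obtain V W where VW: "openin X V" "V \<inter> F \<noteq> {}" "V \<subseteq> K"
      "openin X W" "W \<inter> F \<noteq> {}" "W \<subseteq> L"
      unfolding \<K>_def by blast
    then obtain M where "M \<in> \<K>" "M \<subseteq> V \<inter> W"
      using small[of "V \<inter> W"] irreducible_in_open_Int[OF F(2)] by (metis openin_Int)
    then show "\<exists>M\<in>\<K>. M \<subseteq> K \<and> M \<subseteq> L" using VW by blast
  qed
  \<comment> \<open>Every member of \<open>\<K>\<close> meets \<open>F\<close>, so
    well-filteredness, read contrapositively for the complement of \<open>F\<close>, yields a point
    of \<open>F\<close> common to all members.\<close>
  moreover have "\<not> K \<subseteq> topspace X - F" if "K \<in> \<K>" for K
    using that unfolding \<K>_def by blast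
  moreover have "openin X (topspace X - F)" using F(1) by auto
  ultimately have "\<not> \<Inter>\<K> \<subseteq> topspace X - F"
    using assms(3) \<K> unfolding well_filtered_space_def by blast
  moreover have "\<Inter>\<K> \<subseteq> topspace X" using small[of "topspace X"] FX by auto
  ultimately obtain x where x: "x \<in> \<Inter>\<K>" "x \<in> F" by blast
  have "F \<subseteq> X closure_of {x}"
  proof
    fix y assume y: "y \<in> F"
    \<comment> \<open>Since \<open>U\<close> meets \<open>F\<close> at \<open>y\<close>, it contains
      a member of \<open>\<K>\<close>, and \<open>x\<close> lies in all of these.\<close>
    have "x \<in> U" if "openin X U" "y \<in> U" for U
      using small[OF that(1)] that(2) y x(1) by blast
    then show "y \<in> X closure_of {x}" using y FX by (auto simp: in_closure_of)
  qed
  moreover have "X closure_of {x} \<subseteq> F" using F(1) x(2) by (simp add: closure_of_minimal)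
  ultimately show "\<exists>x\<in>topspace X. F = X closure_of {x}" using x(2) FX by blast
qed

end
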